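(* Let $C$ be a directed cycle and let $\mathcal{S}_C$ be the set of $(f,x)\in\mathbb{R}^{C}\times\{0,1\}^{C}$ satisfying $$-M_C\sum_{(i,j)\in C}(1-x_{ij})\le\sum_{(i,j)\in C}\frac{f_{ij}}{B_{ij}}\le M_C\sum_{(i,j)\in C}(1-x_{ij}),\qquad -\bar f_{ij}x_{ij}\le f_{ij}\le\bar f_{ij}x_{ij}\quad ((i,j)\in C).$$ Then $\operatorname{conv}(\mathcal{S}_C)$ is equal to the set of all $(f,x)\in\mathbb{R}^C\times\mathbb{R}^C$ that satisfy $-\bar f_{ij}x_{ij}\le f_{ij}\le\bar f_{ij}x_{ij}$ and $x_{ij}\le 1$ for all $(i,j)\in C$, together with, for every $S\subseteq C$ with $\Delta(S)>0$, the two inequalities $$-\Delta(S)(|C|-1)+\sum_{(i,j)\in S}[\Delta(S)-w_{ij}]x_{ij}+\Delta(S)\sum_{(i,j)\in C\setminus S}x_{ij}\ \le\ \sum_{(i,j)\in S}\frac{f_{ij}}{B_{ij}}$$ and $$\sum_{(i,j)\in S}\frac{f_{ij}}{B_{ij}}\ \le\ \Delta(S)(|C|-1)-\sum_{(i,j)\in S}[\Delta(S)-w_{ij}]x_{ij}-\Delta(S)\sum_{(i,j)\in C\setminus S}x_{ij}.$$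
   Context: $C$ is (the finite arc set of) a directed cycle in a power network, all of whose arcs are oriented as the corresponding transmission lines. Each $(i,j)\in C$ has a susceptance $B_{ij}>0$ and a capacity $\bar f_{ij}>0$. Set $w_{ij}=\bar f_{ij}/B_{ij}$, $w(S)=\sum_{(i,j)\in S}w_{ij}$ for $S\subseteq C$, and $\Delta(S)=w(S)-w(C\setminus S)=2w(S)-w(C)$. The constant $M_C$ is chosen large enough that the first pair of inequalities defining $\mathcal{S}_C$ is redundant whenever $\sum_{(i,j)\in C}(1-x_{ij})\ge 1$, i.e., it is implied by $x\in\{0,1\}^C$ and $-\bar f_{ij}x_{ij}\le f_{ij}\le\bar f_{ij}x_{ij}$ when at least one $x_{ij}=0$. *)

theory Defs
  imports "HOL-Analysis.Analysis" "Graph_Theory.Pair_Digraph"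
begin

text \<open>
  The buses form a finite type \<open>'v\<close> and a transmission line with its orientation is a pair
  \<open>(i, j)\<close>. For a set \<open>C\<close> of arcs, the space of real vectors indexed by \<open>C\<close> is realised as the
  coordinate subspace of \<open>real ^ ('v \<times> 'v)\<close> of vectors vanishing outside \<open>C\<close>.
\<close>

type_synonym 'v arc_vec = "real ^ ('v \<times> 'v)"

definition vecs_on :: "('v::finite \<times> 'v) set \<Rightarrow> 'v arc_vec set" where
  "vecs_on C = {v. \<forall>a. a \<notin> C \<longrightarrow> v $ a = 0}"

definition binary_on :: "('v::finite \<times> 'v) set \<Rightarrow> 'v arc_vec set" where
  "binary_on C = {x \<in> vecs_on C. \<forall>a\<in>C. x $ a \<in> {0, 1}}"

text \<open>Throughout, \<open>B\<close> is the susceptance and \<open>fbar\<close> the capacity of an arc.\<close>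

definition weight :: "('e \<Rightarrow> real) \<Rightarrow> ('e \<Rightarrow> real) \<Rightarrow> 'e \<Rightarrow> real" where
  "weight B fbar a = fbar a / B a"

definition set_weight :: "('e \<Rightarrow> real) \<Rightarrow> ('e \<Rightarrow> real) \<Rightarrow> 'e set \<Rightarrow> real" where
  "set_weight B fbar S = (\<Sum>a\<in>S. weight B fbar a)"

definition Delta :: "('e \<Rightarrow> real) \<Rightarrow> ('e \<Rightarrow> real) \<Rightarrow> 'e set \<Rightarrow> 'e set \<Rightarrow> real" where
  "Delta B fbar C S = set_weight B fbar S - set_weight B fbar (C - S)"

definition capacity_bounds ::
  "('v::finite \<times> 'v \<Rightarrow> real) \<Rightarrow> ('v \<times> 'v) set \<Rightarrow> 'v arc_vec \<Rightarrow> 'v arc_vec \<Rightarrow> bool" where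
  "capacity_bounds fbar C f x \<longleftrightarrow>
     (\<forall>a\<in>C. - fbar a * x $ a \<le> f $ a \<and> f $ a \<le> fbar a * x $ a)"

definition cycle_bounds ::
  "('v::finite \<times> 'v \<Rightarrow> real) \<Rightarrow> real \<Rightarrow> ('v \<times> 'v) set \<Rightarrow> 'v arc_vec \<Rightarrow> 'v arc_vec \<Rightarrow> bool" where
  "cycle_bounds B M C f x \<longleftrightarrow>
     - M * (\<Sum>a\<in>C. 1 - x $ a) \<le> (\<Sum>a\<in>C. f $ a / B a) \<and>
     (\<Sum>a\<in>C. f $ a / B a) \<le> M * (\<Sum>a\<in>C. 1 - x $ a)"

definition valid_big_M ::
  "('v::finite \<times> 'v \<Rightarrow> real) \<Rightarrow> ('v \<times> 'v \<Rightarrow> real) \<Rightarrow> ('v \<times> 'v) set \<Rightarrow> real \<Rightarrow> bool" where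
  "valid_big_M B fbar C M \<longleftrightarrow>
     (\<forall>f\<in>vecs_on C. \<forall>x\<in>binary_on C.
        capacity_bounds fbar C f x \<and> (\<Sum>a\<in>C. 1 - x $ a) \<ge> 1 \<longrightarrow> cycle_bounds B M C f x)"

definition cycle_set ::
  "('v::finite \<times> 'v \<Rightarrow> real) \<Rightarrow> ('v \<times> 'v \<Rightarrow> real) \<Rightarrow> real \<Rightarrow> ('v \<times> 'v) set
     \<Rightarrow> ('v arc_vec \<times> 'v arc_vec) set" where
  "cycle_set B fbar M C =
     {(f, x). f \<in> vecs_on C \<and> x \<in> binary_on C \<and>
        cycle_bounds B M C f x \<and> capacity_bounds fbar C f x}"

end

theory Submission
  imports Defs
begin

text \<open>
  Write \<open>g a = f a / B a\<close> and \<open>w a = fbar a / B a\<close>, so that the capacity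
  bounds read \<open>\<bar>g a\<bar> \<le> w a * x a\<close>. Because of the choice of \<open>M\<close>, the mixed-integer set is the
  union of two pieces: the points with all arcs closed (\<open>x = 1\<close>), where the big-M constraint becomes the cycle law \<open>\<Sum>g = 0\<close>, and the
  points with an open arc, where only the capacity bounds remain. The hull of the second piece is
  given by the capacity bounds, \<open>x \<le> 1\<close> and \<open>\<Sum>(1 - x) \<ge> 1\<close>
  (\<open>relaxed_point_in_hull\<close>). Hence a point with \<open>x \<le> 1\<close> lies in the hull of the union iff
  it can be split with a weight \<open>\<theta>\<close> between \<open>0\<close> and \<open>1\<close> for the first piece and
  a share \<open>h\<close> of \<open>g\<close> such that
  \<open>\<Sum>h = 0\<close>, \<open>\<bar>h a\<bar> \<le> \<theta> * w a\<close> and \<open>\<bar>g a - h a\<bar> \<le> w a * (x a - \<theta>)\<close>, where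
  \<open>1 - \<theta> \<le> \<Sum>(1 - x)\<close>.

  Moving weight from the first piece to the second only relaxes the conditions on \<open>h\<close>, so the
  decisive choice is \<open>\<theta> = 1 - \<Sum>(1 - x)\<close> (or \<open>0\<close> if this is negative). For fixed
  \<open>\<theta>\<close>, each \<open>h a\<close> ranges over an interval, and a choice with \<open>\<Sum>h = 0\<close> exists iff the
  lower ends sum to at most \<open>0\<close> and the upper ends to at least \<open>0\<close>. Each lower end is a
  maximum, of \<open>g a - w a * (x a - \<theta>)\<close> and \<open>- \<theta> * w a\<close>; deciding for each arc which of the
  two is taken, with \<open>S\<close> the set of arcs where it is the first one, turns the condition on the
  lower ends into one inequality per subset, namely \<open>\<Sum>\<^sub>S g \<le> \<Sum>\<^sub>S w x - \<theta> * \<Delta>(S)\<close>. After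
  substitution of \<open>\<theta>\<close> this is the stated inequality (\<open>cycle_inequality_rewrite\<close>), and it follows from the
  capacity bounds when \<open>\<Delta>(S) \<le> 0\<close>. If \<open>\<Sum>(1 - x) > 1\<close>, the stated inequalities are weaker
  than the capacity bounds, in accordance with \<open>\<theta> = 0\<close>, for which \<open>h = 0\<close> works.
  The upper ends give the same inequalities for \<open>-g\<close>.
\<close>

section \<open>Splitting a flow between the two pieces\<close>

lemma exists_point_in_box_with_sum:
  fixes l u :: "'e \<Rightarrow> real"
  assumes "\<And>a. a \<in> A \<Longrightarrow> l a \<le> u a" and "sum l A \<le> s" and "s \<le> sum u A"
  shows "\<exists>h. sum h A = s \<and> (\<forall>a\<in>A. l a \<le> h a \<and> h a \<le> u a)"
proof (cases "sum l A = sum u A")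
  case True
  then show ?thesis using assms by (intro exI[of _ l]) auto
next
  case False
  define t where "t = (s - sum l A) / (sum u A - sum l A)"
  have t: "0 \<le> t" "t \<le> 1" and ts: "t * (sum u A - sum l A) = s - sum l A"
    using assms False by (auto simp: t_def field_simps)
  define h where "h a = l a + t * (u a - l a)" for a
  have "sum h A = sum l A + t * (sum u A - sum l A)"
    by (simp add: h_def sum.distrib sum_subtractf flip: sum_distrib_left)
  moreover have "l a \<le> h a \<and> h a \<le> u a" if "a \<in> A" for a
  proof -
    have "0 \<le> u a - l a" using assms(1)[OF that] by simp
    then have "0 \<le> t * (u a - l a)" "t * (u a - l a) \<le> 1 * (u a - l a)"
      using t by (simp, intro mult_right_mono)
    then show ?thesis by (simp add: h_def)
  qed
  ultimately show ?thesis using ts by auto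
qed

text \<open>
  Taking for \<open>S\<close> the arcs on which the first argument attains the maximum gives the bound.
\<close>
lemma sum_max_le_if_subset_sums_le:
  fixes p q :: "'e \<Rightarrow> real"
  assumes "finite A" and "\<And>S. S \<subseteq> A \<Longrightarrow> sum p S + sum q (A - S) \<le> c"
  shows "(\<Sum>a\<in>A. max (p a) (q a)) \<le> c"
proof -
  define S where "S = {a \<in> A. q a \<le> p a}"
  have "(\<Sum>a\<in>A. max (p a) (q a)) = (\<Sum>a\<in>S. max (p a) (q a)) + (\<Sum>a\<in>A - S. max (p a) (q a))"
    using assms(1) by (subst sum.subset_diff[of S]) (auto simp: S_def)
  also have "(\<Sum>a\<in>S. max (p a) (q a)) = sum p S"
    by (rule sum.cong) (auto simp: S_def)
  also have "(\<Sum>a\<in>A - S. max (p a) (q a)) = sum q (A - S)"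
    by (rule sum.cong) (auto simp: S_def)
  also have "sum p S + sum q (A - S) \<le> c"
    by (rule assms(2)) (auto simp: S_def)
  finally show ?thesis .
qed

text \<open>
  The two constraints on \<open>h a\<close> confine it to the interval from
  \<open>max (g a - w a * (x a - \<theta>)) (- \<theta> * w a)\<close> to the negative of the same expression for \<open>-g\<close>.
  The subset inequalities say exactly that \<open>0\<close> lies between the sums of the interval ends.
\<close>
lemma exists_balanced_share:
  fixes g w x :: "'e \<Rightarrow> real"
  assumes fin: "finite A"
    and cap: "\<And>a. a \<in> A \<Longrightarrow> \<bar>g a\<bar> \<le> w a * x a"
    and w: "\<And>a. a \<in> A \<Longrightarrow> 0 \<le> w a"
    and lam: "0 \<le> \<theta>" "\<And>a. a \<in> A \<Longrightarrow> \<theta> \<le> x a"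
    and sub: "\<And>S. S \<subseteq> A \<Longrightarrow>
      \<bar>sum g S\<bar> \<le> (\<Sum>a\<in>S. w a * x a) - \<theta> * (sum w S - sum w (A - S))"
  shows "\<exists>h. sum h A = 0 \<and> (\<forall>a\<in>A. \<bar>h a\<bar> \<le> \<theta> * w a \<and> \<bar>g a - h a\<bar> \<le> w a * (x a - \<theta>))"
proof -
  define lo where "lo k a = max (k a - w a * (x a - \<theta>)) (- (\<theta> * w a))" for k :: "'e \<Rightarrow> real" and a
  have sum_lo: "sum (lo k) A \<le> 0"
    if k: "\<And>S. S \<subseteq> A \<Longrightarrow> sum k S \<le> (\<Sum>a\<in>S. w a * x a) - \<theta> * (sum w S - sum w (A - S))" for k
    unfolding lo_def
  proof (rule sum_max_le_if_subset_sums_le[OF fin])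
    fix S assume "S \<subseteq> A"
    from k[OF this] show
      "(\<Sum>a\<in>S. k a - w a * (x a - \<theta>)) + (\<Sum>a\<in>A - S. - (\<theta> * w a)) \<le> 0"
      by (simp add: sum_subtractf sum_negf sum_distrib_left algebra_simps sum.distrib)
  qed
  have lower: "sum (lo g) A \<le> 0"
    using sub by (intro sum_lo) (simp add: abs_le_iff)
  have "sum (lo (\<lambda>a. - g a)) A \<le> 0"
    using sub by (intro sum_lo) (simp add: abs_le_iff sum_negf)
  then have upper: "0 \<le> (\<Sum>a\<in>A. - lo (\<lambda>a. - g a) a)"
    by (simp add: sum_negf)
  have "lo g a \<le> - lo (\<lambda>a. - g a) a" if "a \<in> A" for a
  proof -
    have "0 \<le> w a * \<theta>" "w a * \<theta> \<le> w a * x a"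
      using w[OF that] lam that by (auto intro: mult_left_mono)
    then show ?thesis
      using cap[OF that] by (auto simp: lo_def max_def abs_le_iff algebra_simps)
  qed
  from exists_point_in_box_with_sum[OF this lower upper] obtain h
    where h: "sum h A = 0" "\<And>a. a \<in> A \<Longrightarrow> lo g a \<le> h a \<and> h a \<le> - lo (\<lambda>a. - g a) a"
    by blast
  have "\<bar>h a\<bar> \<le> \<theta> * w a \<and> \<bar>g a - h a\<bar> \<le> w a * (x a - \<theta>)" if "a \<in> A" for a
    using h(2)[OF that] by (auto simp: lo_def abs_le_iff)
  with h(1) show ?thesis by blast
qed

section \<open>The hull of the points with an open arc\<close>

text \<open>An arc \<open>a\<close> is called open when \<open>x a = 0\<close>, as a switch is when its line is off.\<close>
definition open_points ::
  "('v::finite \<times> 'v \<Rightarrow> real) \<Rightarrow> ('v \<times> 'v) set \<Rightarrow> ('v arc_vec \<times> 'v arc_vec) set" where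
  "open_points fbar C =
     {(f, x). f \<in> vecs_on C \<and> x \<in> binary_on C \<and> capacity_bounds fbar C f x \<and> (\<exists>a\<in>C. x $ a = 0)}"

definition scale_by ::
  "('i \<Rightarrow> real) \<Rightarrow> ('i \<Rightarrow> real) \<Rightarrow> (real ^ 'i::finite) \<times> (real ^ 'i) \<Rightarrow> (real ^ 'i) \<times> (real ^ 'i)" where
  "scale_by \<alpha> \<beta> z = (\<chi> i. \<alpha> i * fst z $ i, \<chi> i. \<beta> i * snd z $ i)"

lemma linear_scale_by: "linear (scale_by \<alpha> \<beta>)"
  by (rule linearI) (auto simp: scale_by_def vec_eq_iff algebra_simps)

lemma scale_by_hull_invariant:
  assumes "\<And>z. z \<in> X \<Longrightarrow> scale_by \<alpha> \<beta> z \<in> X" and "z \<in> convex hull X"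
  shows "scale_by \<alpha> \<beta> z \<in> convex hull X"
proof -
  have "scale_by \<alpha> \<beta> z \<in> convex hull (scale_by \<alpha> \<beta> ` X)"
    using assms(2) by (simp flip: convex_hull_linear_image[OF linear_scale_by])
  also have "\<dots> \<subseteq> convex hull X"
    using assms(1) by (intro hull_mono) auto
  finally show ?thesis .
qed

text \<open>
  Reversing the flow on one arc, and opening one arc, are linear maps that preserve the set of
  points with an open arc. Convex combinations of these maps with the identity shrink a
  single coordinate pair by any admissible factors.
\<close>
lemma scale_coordinate_open_hull:
  assumes z: "z \<in> convex hull open_points fbar C"
    and r: "\<bar>r\<bar> \<le> 1" and t: "0 \<le> t" "t \<le> 1"
  shows "scale_by ((\<lambda>_. 1)(a := r * t)) ((\<lambda>_. 1)(a := t)) z \<in> convex hull open_points fbar C"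
proof -
  let ?K = "convex hull open_points fbar C"
  define y where "y = scale_by ((\<lambda>_. 1)(a := r)) (\<lambda>_. 1) z"
  have "scale_by ((\<lambda>_. 1)(a := -1)) (\<lambda>_. 1) z \<in> ?K"
    by (rule scale_by_hull_invariant[OF _ z])
      (fastforce simp: scale_by_def open_points_def vecs_on_def binary_on_def capacity_bounds_def)
  from convexD[OF convex_convex_hull z this, of "(1 + r) / 2" "(1 - r) / 2"]
  have "((1 + r) / 2) *\<^sub>R z + ((1 - r) / 2) *\<^sub>R scale_by ((\<lambda>_. 1)(a := -1)) (\<lambda>_. 1) z \<in> ?K"
    using r by (simp add: abs_le_iff field_simps)
  also have "((1 + r) / 2) *\<^sub>R z + ((1 - r) / 2) *\<^sub>R scale_by ((\<lambda>_. 1)(a := -1)) (\<lambda>_. 1) z = y"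
    by (cases z) (auto simp: y_def scale_by_def vec_eq_iff field_simps)
  finally have y: "y \<in> ?K" .
  have "scale_by ((\<lambda>_. 1)(a := 0)) ((\<lambda>_. 1)(a := 0)) y \<in> ?K"
    by (rule scale_by_hull_invariant[OF _ y])
      (fastforce simp: scale_by_def open_points_def vecs_on_def binary_on_def capacity_bounds_def)
  from convexD[OF convex_convex_hull y this, of t "1 - t"]
  have "t *\<^sub>R y + (1 - t) *\<^sub>R scale_by ((\<lambda>_. 1)(a := 0)) ((\<lambda>_. 1)(a := 0)) y \<in> ?K"
    using t by simp
  also have "t *\<^sub>R y + (1 - t) *\<^sub>R scale_by ((\<lambda>_. 1)(a := 0)) ((\<lambda>_. 1)(a := 0)) y
    = scale_by ((\<lambda>_. 1)(a := r * t)) ((\<lambda>_. 1)(a := t)) z"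
    by (auto simp: y_def scale_by_def vec_eq_iff algebra_simps)
  finally show ?thesis .
qed

lemma scale_open_hull:
  fixes fbar :: "'v::finite \<times> 'v \<Rightarrow> real" and r t :: "'v \<times> 'v \<Rightarrow> real"
  assumes z: "z \<in> convex hull open_points fbar C"
    and "\<And>a. \<bar>r a\<bar> \<le> 1" and "\<And>a. 0 \<le> t a" and "\<And>a. t a \<le> 1"
  shows "scale_by (\<lambda>a. r a * t a) t z \<in> convex hull open_points fbar C"
proof -
  have "scale_by (\<lambda>a. if a \<in> A then r a * t a else 1) (\<lambda>a. if a \<in> A then t a else 1) z
      \<in> convex hull open_points fbar C" (is "?s A \<in> ?K") if "finite A" for A
    using that
  proof induction
    case empty
    have "?s {} = z" by (simp add: scale_by_def)
    with z show ?case by simp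
  next
    case (insert a A)
    have "?s (insert a A) = scale_by ((\<lambda>_. 1)(a := r a * t a)) ((\<lambda>_. 1)(a := t a)) (?s A)"
      using insert.hyps by (auto simp: scale_by_def vec_eq_iff)
    with scale_coordinate_open_hull[OF insert.IH] assms show ?case by simp
  qed
  from this[of UNIV] show ?thesis by simp
qed

text \<open>
  Averaging, with weights \<open>\<mu> b\<close>, the points where exactly arc \<open>b\<close> is open and all others carry full
  capacity. Such an average is the maximal point below which the relaxed points are found.
\<close>
lemma full_capacity_point_in_open_hull:
  fixes fbar :: "'v::finite \<times> 'v \<Rightarrow> real"
  assumes "\<And>a. a \<in> C \<Longrightarrow> 0 < fbar a" and "\<And>a. a \<in> C \<Longrightarrow> 0 \<le> \<mu> a" and "sum \<mu> C = 1"
  shows "(\<chi> a. if a \<in> C then fbar a * (1 - \<mu> a) else 0, \<chi> a. if a \<in> C then 1 - \<mu> a else 0)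
    \<in> convex hull open_points fbar C"
proof -
  define v :: "'v \<times> 'v \<Rightarrow> 'v arc_vec \<times> 'v arc_vec" where
    "v b = (\<chi> a. if a \<in> C - {b} then fbar a else 0, \<chi> a. if a \<in> C - {b} then 1 else 0)" for b
  have "v b \<in> convex hull open_points fbar C" if "b \<in> C" for b
    by (rule hull_inc) (use that assms(1) in
      \<open>force simp: v_def open_points_def vecs_on_def binary_on_def capacity_bounds_def intro: less_imp_le\<close>)
  then have mem: "(\<Sum>b\<in>C. \<mu> b *\<^sub>R v b) \<in> convex hull open_points fbar C"
    using assms by (intro convex_sum) auto
  have avg: "(\<Sum>b\<in>C. \<mu> b * (if a \<in> C - {b} then c else 0)) = (if a \<in> C then c * (1 - \<mu> a) else 0)"
    for a and c :: real
  proof (cases "a \<in> C")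
    case True
    have "(\<Sum>b\<in>C. \<mu> b * (if a \<in> C - {b} then c else 0)) = (\<Sum>b\<in>C - {a}. \<mu> b * c)"
      using True by (subst sum.remove[of _ a]) (auto intro!: sum.cong split: if_splits)
    also have "\<dots> = c * (1 - \<mu> a)"
      using True assms(3) by (simp add: sum_diff1 flip: sum_distrib_right)
    finally show ?thesis using True by simp
  qed simp
  have "(\<Sum>b\<in>C. \<mu> b *\<^sub>R v b) =
    (\<chi> a. if a \<in> C then fbar a * (1 - \<mu> a) else 0, \<chi> a. if a \<in> C then 1 - \<mu> a else 0)"
  proof (rule prod_eqI)
    show "fst (\<Sum>b\<in>C. \<mu> b *\<^sub>R v b) = fst
      (\<chi> a. if a \<in> C then fbar a * (1 - \<mu> a) else 0, \<chi> a. if a \<in> C then 1 - \<mu> a else 0)"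
      by (simp only: v_def fst_sum vec_eq_iff sum_component fst_scaleR vector_scaleR_component
          fst_conv vec_lambda_beta real_scaleR_def avg simp_thms)
    show "snd (\<Sum>b\<in>C. \<mu> b *\<^sub>R v b) = snd
      (\<chi> a. if a \<in> C then fbar a * (1 - \<mu> a) else 0, \<chi> a. if a \<in> C then 1 - \<mu> a else 0)"
      by (simp only: v_def snd_sum vec_eq_iff sum_component snd_scaleR vector_scaleR_component
          snd_conv vec_lambda_beta real_scaleR_def avg simp_thms mult_1_left)
  qed
  with mem show ?thesis by (simp only:)
qed

text \<open>
  Normalising the gaps \<open>1 - x a\<close> to weights \<open>\<mu>\<close> of sum one can only shrink them, so the average
  above has switching values \<open>1 - \<mu> a \<ge> x a\<close>; scaling its coordinates down yields the given point.
\<close>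
lemma relaxed_point_in_hull:
  fixes f x :: "'v::finite arc_vec"
  assumes fbar: "\<And>a. a \<in> C \<Longrightarrow> 0 < fbar a"
    and on: "f \<in> vecs_on C" "x \<in> vecs_on C"
    and cap: "capacity_bounds fbar C f x"
    and x: "\<And>a. a \<in> C \<Longrightarrow> 0 \<le> x $ a \<and> x $ a \<le> 1"
    and gap: "1 \<le> (\<Sum>a\<in>C. 1 - x $ a)"
  shows "(f, x) \<in> convex hull open_points fbar C"
proof -
  define \<mu> where "\<mu> a = (1 - x $ a) / (\<Sum>a\<in>C. 1 - x $ a)" for a
  have \<mu>: "0 \<le> \<mu> a" "x $ a \<le> 1 - \<mu> a" if "a \<in> C" for a
  proof -
    show "0 \<le> \<mu> a" using x[OF that] gap by (simp add: \<mu>_def)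
    have "\<mu> a \<le> (1 - x $ a) / 1"
      unfolding \<mu>_def using x[OF that] gap by (intro divide_left_mono) auto
    then show "x $ a \<le> 1 - \<mu> a" by simp
  qed
  have "sum \<mu> C = 1"
    using gap by (simp add: \<mu>_def flip: sum_divide_distrib)
  then have start: "(\<chi> a. if a \<in> C then fbar a * (1 - \<mu> a) else 0, \<chi> a. if a \<in> C then 1 - \<mu> a else 0)
      \<in> convex hull open_points fbar C"
    using fbar \<mu>(1) by (intro full_capacity_point_in_open_hull)
  \<comment> \<open>Where a denominator vanishes, so does the numerator, and the resulting factor \<open>0\<close> is admissible.\<close>
  define r where "r a = (if a \<in> C then f $ a / (fbar a * x $ a) else 0)" for a
  define t where "t a = (if a \<in> C then x $ a / (1 - \<mu> a) else 0)" for a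
  have absf: "\<bar>f $ a\<bar> \<le> fbar a * x $ a" if "a \<in> C" for a
    using cap that by (auto simp: capacity_bounds_def abs_le_iff)
  have r: "\<bar>r a\<bar> \<le> 1" for a
    using absf fbar x by (auto simp: r_def abs_mult divide_le_eq_1 less_le)
  have t: "0 \<le> t a \<and> t a \<le> 1" for a
  proof (cases "a \<in> C")
    case True
    with x[OF True] \<mu>(2)[OF True] show ?thesis by (simp add: t_def divide_le_eq_1) linarith
  qed (simp add: t_def)
  have tx: "t a * (1 - \<mu> a) = x $ a" if "a \<in> C" for a
    using x[OF that] \<mu>(2)[OF that] that by (auto simp: t_def)
  have rf: "r a * (fbar a * x $ a) = f $ a" if "a \<in> C" for a
    using absf[OF that] that by (auto simp: r_def)
  have rtf: "r a * t a * (fbar a * (1 - \<mu> a)) = f $ a" if "a \<in> C" for a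
  proof -
    have "r a * t a * (fbar a * (1 - \<mu> a)) = r a * (fbar a * (t a * (1 - \<mu> a)))"
      by (simp add: algebra_simps)
    also have "\<dots> = f $ a" by (simp only: tx[OF that] rf[OF that])
    finally show ?thesis .
  qed
  have "scale_by (\<lambda>a. r a * t a) t
      (\<chi> a. if a \<in> C then fbar a * (1 - \<mu> a) else 0, \<chi> a. if a \<in> C then 1 - \<mu> a else 0) = (f, x)"
    using on tx rtf by (auto simp: scale_by_def vec_eq_iff vecs_on_def)
  with scale_open_hull[OF start, where r = r and t = t] r t show ?thesis by simp
qed

section \<open>The cycle inequalities\<close>

text \<open>
  For \<open>D = \<Delta>(S)\<close>, the left-hand side is the bound of the theorem. On the right, \<open>D\<close> is multiplied
  by the weight \<open>\<theta>\<close> that the splitting argument gives to the points with all arcs closed.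
\<close>
lemma cycle_inequality_rewrite:
  fixes x :: "'v::finite arc_vec" and C :: "('v \<times> 'v) set"
  assumes "S \<subseteq> C"
  shows "D * (real (card C) - 1) - (\<Sum>a\<in>S. (D - w a) * x $ a) - D * (\<Sum>a\<in>C - S. x $ a)
    = (\<Sum>a\<in>S. w a * x $ a) - D * (1 - (\<Sum>a\<in>C. 1 - x $ a))"
proof -
  have "(\<Sum>a\<in>C. x $ a) = (\<Sum>a\<in>C - S. x $ a) + (\<Sum>a\<in>S. x $ a)"
    using assms by (intro sum.subset_diff) auto
  then show ?thesis
    by (simp add: sum_subtractf algebra_simps sum_distrib_left)
qed

text \<open>
  Replacing \<open>f\<close> by \<open>-f\<close> exchanges the two inequalities for a subset \<open>S\<close>; here they are merged into one bound on an absolute value, in the form in which the splitting argument produces it.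
\<close>
definition cycle_polytope ::
  "('v::finite \<times> 'v \<Rightarrow> real) \<Rightarrow> ('v \<times> 'v \<Rightarrow> real) \<Rightarrow> ('v \<times> 'v) set
     \<Rightarrow> ('v arc_vec \<times> 'v arc_vec) set" where
  "cycle_polytope B fbar C =
    {(f, x). f \<in> vecs_on C \<and> x \<in> vecs_on C \<and>
       capacity_bounds fbar C f x \<and> (\<forall>a\<in>C. x $ a \<le> 1) \<and>
       (\<forall>S. S \<subseteq> C \<and> Delta B fbar C S > 0 \<longrightarrow>
          \<bar>\<Sum>a\<in>S. f $ a / B a\<bar>
            \<le> (\<Sum>a\<in>S. weight B fbar a * x $ a)
              - Delta B fbar C S * (1 - (\<Sum>a\<in>C. 1 - x $ a)))}"

lemma convex_cycle_polytope: "convex (cycle_polytope B fbar C)"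
proof (rule convexI)
  fix z1 z2 :: "'a arc_vec \<times> 'a arc_vec" and u v :: real
  assume z: "z1 \<in> cycle_polytope B fbar C" "z2 \<in> cycle_polytope B fbar C"
    and uv: "0 \<le> u" "0 \<le> v" "u + v = 1"
  obtain f1 x1 f2 x2 where z_eq: "z1 = (f1, x1)" "z2 = (f2, x2)" by (cases z1, cases z2)
  \<comment> \<open>Every constraint bounds a convex function of \<open>(f, x)\<close> by an affine one.\<close>
  have le: "u * p1 + v * p2 \<le> u * q1 + v * q2" if "p1 \<le> q1" "p2 \<le> q2" for p1 p2 q1 q2 :: real
    using that uv by (intro add_mono mult_left_mono)
  have cap: "- fbar a * (u * x1 $ a + v * x2 $ a) \<le> u * f1 $ a + v * f2 $ a
      \<and> u * f1 $ a + v * f2 $ a \<le> fbar a * (u * x1 $ a + v * x2 $ a)" if "a \<in> C" for a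
    using z that le[of "- fbar a * x1 $ a" "f1 $ a" "- fbar a * x2 $ a" "f2 $ a"]
      le[of "f1 $ a" "fbar a * x1 $ a" "f2 $ a" "fbar a * x2 $ a"]
    by (auto simp: z_eq cycle_polytope_def capacity_bounds_def algebra_simps)
  have one: "u * x1 $ a + v * x2 $ a \<le> 1" if "a \<in> C" for a
    using z that uv le[of "x1 $ a" 1 "x2 $ a" 1] by (auto simp: z_eq cycle_polytope_def)
  have cyc: "\<bar>\<Sum>a\<in>S. (u * f1 $ a + v * f2 $ a) / B a\<bar>
      \<le> (\<Sum>a\<in>S. weight B fbar a * (u * x1 $ a + v * x2 $ a))
        - Delta B fbar C S * (1 - (\<Sum>a\<in>C. 1 - (u * x1 $ a + v * x2 $ a)))"
    if S: "S \<subseteq> C" "Delta B fbar C S > 0" for S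
  proof -
    let ?R = "\<lambda>x :: 'a arc_vec. (\<Sum>a\<in>S. weight B fbar a * x $ a)
      - Delta B fbar C S * (1 - (\<Sum>a\<in>C. 1 - x $ a))"
    have gap: "(\<Sum>a\<in>C. 1 - (u * x1 $ a + v * x2 $ a))
        = u * (\<Sum>a\<in>C. 1 - x1 $ a) + v * (\<Sum>a\<in>C. 1 - x2 $ a)"
    proof -
      have "1 - (u * x1 $ a + v * x2 $ a) = u * (1 - x1 $ a) + v * (1 - x2 $ a)" for a
        using uv(3) by (simp add: algebra_simps)
      then show ?thesis by (simp add: sum.distrib sum_distrib_left)
    qed
    have ws: "(\<Sum>a\<in>S. weight B fbar a * (u * x1 $ a + v * x2 $ a))
        = u * (\<Sum>a\<in>S. weight B fbar a * x1 $ a) + v * (\<Sum>a\<in>S. weight B fbar a * x2 $ a)"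
      by (simp add: sum.distrib sum_distrib_left algebra_simps)
    have affine: "(u * p1 + v * p2) - D * (1 - (u * q1 + v * q2))
        = u * (p1 - D * (1 - q1)) + v * (p2 - D * (1 - q2))" for p1 p2 q1 q2 D :: real
    proof -
      have v: "v = 1 - u" using uv(3) by simp
      show ?thesis unfolding v by (simp add: algebra_simps)
    qed
    have R: "?R (u *\<^sub>R x1 + v *\<^sub>R x2) = u * ?R x1 + v * ?R x2"
      unfolding vector_add_component vector_scaleR_component real_scaleR_def gap ws
      by (rule affine)
    have "(\<Sum>a\<in>S. (u * f1 $ a + v * f2 $ a) / B a)
        = u * (\<Sum>a\<in>S. f1 $ a / B a) + v * (\<Sum>a\<in>S. f2 $ a / B a)"
      by (simp add: add_divide_distrib sum.distrib sum_distrib_left)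
    also have "\<bar>\<dots>\<bar> \<le> u * \<bar>\<Sum>a\<in>S. f1 $ a / B a\<bar> + v * \<bar>\<Sum>a\<in>S. f2 $ a / B a\<bar>"
      using uv by (intro order_trans[OF abs_triangle_ineq]) (simp add: abs_mult)
    also have "\<dots> \<le> u * ?R x1 + v * ?R x2"
      using z S by (intro le) (auto simp: z_eq cycle_polytope_def)
    finally show ?thesis using R by simp
  qed
  show "u *\<^sub>R z1 + v *\<^sub>R z2 \<in> cycle_polytope B fbar C"
    using z cap one cyc
    by (auto simp: z_eq cycle_polytope_def vecs_on_def capacity_bounds_def)
qed

lemma abs_flow_le_weight:
  assumes "0 < B a" "capacity_bounds fbar C f x" "a \<in> C"
  shows "\<bar>f $ a / B a\<bar> \<le> weight B fbar a * x $ a"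
  using assms by (auto simp: weight_def capacity_bounds_def abs_le_iff field_simps)

text \<open>
  With all arcs closed, \<open>\<Sum>\<^sub>S g = - \<Sum>\<^sub>C\<^sub>-\<^sub>S g\<close>, and the inequality bounds this by
  \<open>w(C - S) = w(S) - \<Delta>(S)\<close>. With an open arc, the factor \<open>1 - \<Sum>(1 - x)\<close> of \<open>\<Delta>(S)\<close> is
  nonpositive and the capacity bounds suffice.
\<close>
lemma cycle_set_subset_polytope:
  assumes B: "\<And>a. a \<in> C \<Longrightarrow> 0 < B a"
  shows "cycle_set B fbar M C \<subseteq> cycle_polytope B fbar C"
proof clarify
  fix f x assume "(f, x) \<in> cycle_set B fbar M C"
  then have on: "f \<in> vecs_on C" "x \<in> vecs_on C" and bin: "\<And>a. a \<in> C \<Longrightarrow> x $ a = 0 \<or> x $ a = 1"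
    and cyc: "cycle_bounds B M C f x" and cap: "capacity_bounds fbar C f x"
    by (auto simp: cycle_set_def binary_on_def)
  have g: "\<bar>\<Sum>a\<in>S. f $ a / B a\<bar> \<le> (\<Sum>a\<in>S. weight B fbar a * x $ a)" if "S \<subseteq> C" for S
    using that B by (intro order_trans[OF sum_abs] sum_mono abs_flow_le_weight[OF _ cap]) auto
  have "\<bar>\<Sum>a\<in>S. f $ a / B a\<bar> \<le> (\<Sum>a\<in>S. weight B fbar a * x $ a)
      - Delta B fbar C S * (1 - (\<Sum>a\<in>C. 1 - x $ a))"
    if S: "S \<subseteq> C" "Delta B fbar C S > 0" for S
  proof (cases "\<forall>a\<in>C. x $ a = 1")
    case True
    then have "(\<Sum>a\<in>C. f $ a / B a) = 0"
      using cyc by (auto simp: cycle_bounds_def)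
    then have "(\<Sum>a\<in>S. f $ a / B a) = - (\<Sum>a\<in>C - S. f $ a / B a)"
      using S(1) by (simp add: sum_diff)
    then have "\<bar>\<Sum>a\<in>S. f $ a / B a\<bar> \<le> (\<Sum>a\<in>C - S. weight B fbar a * x $ a)"
      using g[of "C - S"] by simp
    also have "\<dots> = set_weight B fbar (C - S)"
      using True by (simp add: set_weight_def)
    also have "\<dots> = set_weight B fbar S - Delta B fbar C S"
      by (simp add: Delta_def)
    also have "set_weight B fbar S = (\<Sum>a\<in>S. weight B fbar a * x $ a)"
      using True S(1) by (auto simp: set_weight_def intro!: sum.cong)
    finally show ?thesis using True by simp
  next
    case False
    then obtain b where b: "b \<in> C" "x $ b = 0" using bin by auto
    have "1 - x $ b \<le> (\<Sum>a\<in>C. 1 - x $ a)"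
      using b bin by (intro member_le_sum) force+
    then have "Delta B fbar C S * (1 - (\<Sum>a\<in>C. 1 - x $ a)) \<le> 0"
      using S(2) b(2) by (intro mult_nonneg_nonpos) auto
    with g[OF S(1)] show ?thesis by simp
  qed
  moreover have "\<forall>a\<in>C. x $ a \<le> 1"
    using bin by force
  ultimately show "(f, x) \<in> cycle_polytope B fbar C"
    using on cap by (simp add: cycle_polytope_def)
qed

lemma open_points_subset_cycle_set:
  assumes "valid_big_M B fbar C M"
  shows "open_points fbar C \<subseteq> cycle_set B fbar M C"
proof clarify
  fix f x assume "(f, x) \<in> open_points fbar C"
  then obtain b where p: "f \<in> vecs_on C" "x \<in> binary_on C" "capacity_bounds fbar C f x"
    and b: "b \<in> C" "x $ b = 0"
    by (auto simp: open_points_def)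
  have "0 \<le> 1 - x $ a" if "a \<in> C" for a
    using p(2) that by (auto simp: binary_on_def)
  then have "1 - x $ b \<le> (\<Sum>a\<in>C. 1 - x $ a)"
    using b by (intro member_le_sum) auto
  with b p assms show "(f, x) \<in> cycle_set B fbar M C"
    by (auto simp: valid_big_M_def cycle_set_def)
qed

lemma closed_point_in_cycle_set:
  fixes f :: "'v::finite arc_vec"
  assumes "f \<in> vecs_on C" and "\<And>a. a \<in> C \<Longrightarrow> \<bar>f $ a\<bar> \<le> fbar a" and "(\<Sum>a\<in>C. f $ a / B a) = 0"
  shows "(f, \<chi> a. if a \<in> C then 1 else 0) \<in> cycle_set B fbar M C"
  using assms
  by (force simp: cycle_set_def binary_on_def vecs_on_def cycle_bounds_def capacity_bounds_def abs_le_iff)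

text \<open>
  Only the case \<open>0 < \<theta> < 1\<close> mixes the two pieces: the point is then \<open>\<theta>\<close> times a point with all
  arcs closed, carrying the flow \<open>B * h / \<theta>\<close>, plus \<open>1 - \<theta>\<close> times a point to which
  \<open>relaxed_point_in_hull\<close> applies.
\<close>
lemma polytope_subset_hull:
  fixes C :: "('v::finite \<times> 'v) set"
  assumes B: "\<And>a. a \<in> C \<Longrightarrow> 0 < B a" and fbar: "\<And>a. a \<in> C \<Longrightarrow> 0 < fbar a"
    and M: "valid_big_M B fbar C M"
  shows "cycle_polytope B fbar C \<subseteq> convex hull cycle_set B fbar M C"
proof clarify
  fix f x assume "(f, x) \<in> cycle_polytope B fbar C"
  then have on: "f \<in> vecs_on C" "x \<in> vecs_on C" and cap: "capacity_bounds fbar C f x"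
    and x1: "\<And>a. a \<in> C \<Longrightarrow> x $ a \<le> 1"
    and cyc: "\<And>S. S \<subseteq> C \<Longrightarrow> Delta B fbar C S > 0 \<Longrightarrow>
      \<bar>\<Sum>a\<in>S. f $ a / B a\<bar> \<le> (\<Sum>a\<in>S. weight B fbar a * x $ a)
        - Delta B fbar C S * (1 - (\<Sum>a\<in>C. 1 - x $ a))"
    by (auto simp: cycle_polytope_def)
  let ?K = "convex hull cycle_set B fbar M C"
  have "convex hull open_points fbar C \<subseteq> ?K"
    by (intro hull_mono open_points_subset_cycle_set M)
  then have relaxed: "(f', x') \<in> ?K"
    if "f' \<in> vecs_on C" "x' \<in> vecs_on C" "capacity_bounds fbar C f' x'"
      "\<And>a. a \<in> C \<Longrightarrow> 0 \<le> x' $ a \<and> x' $ a \<le> 1" "1 \<le> (\<Sum>a\<in>C. 1 - x' $ a)" for f' x'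
    using relaxed_point_in_hull[OF fbar that] by blast
  have x0: "0 \<le> x $ a" if "a \<in> C" for a
  proof -
    have "0 \<le> 2 * fbar a * x $ a" using cap that by (force simp: capacity_bounds_def)
    then show ?thesis using fbar[OF that] by (simp add: zero_le_mult_iff)
  qed
  define \<theta> where "\<theta> = 1 - (\<Sum>a\<in>C. 1 - x $ a)"
  have \<theta>_le: "\<theta> \<le> x $ b" if "b \<in> C" for b
  proof -
    have "1 - x $ b \<le> (\<Sum>a\<in>C. 1 - x $ a)" using x1 that by (intro member_le_sum) auto
    then show ?thesis by (simp add: \<theta>_def)
  qed
  have \<theta>1: "\<theta> \<le> 1" using x1 by (simp add: \<theta>_def sum_nonneg)
  show "(f, x) \<in> ?K"
  proof (cases "\<theta> \<le> 0")
    case True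
    then show ?thesis using on cap x0 x1 by (intro relaxed) (auto simp: \<theta>_def)
  next
    case False
    then have \<theta>0: "0 < \<theta>" by simp
    let ?w = "weight B fbar"
    have g: "\<bar>f $ a / B a\<bar> \<le> ?w a * x $ a" if "a \<in> C" for a
      by (rule abs_flow_le_weight[where B = B and a = a, OF B[OF that] cap that])
    have "\<exists>h. sum h C = 0 \<and>
        (\<forall>a\<in>C. \<bar>h a\<bar> \<le> \<theta> * ?w a \<and> \<bar>f $ a / B a - h a\<bar> \<le> ?w a * (x $ a - \<theta>))"
    proof (rule exists_balanced_share)
      show "0 \<le> ?w a" if "a \<in> C" for a
        using B[OF that] fbar[OF that] by (simp add: weight_def)
      fix S assume S: "S \<subseteq> C"
      have D: "sum ?w S - sum ?w (C - S) = Delta B fbar C S"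
        by (simp add: Delta_def set_weight_def)
      show "\<bar>\<Sum>a\<in>S. f $ a / B a\<bar> \<le> (\<Sum>a\<in>S. ?w a * x $ a) - \<theta> * (sum ?w S - sum ?w (C - S))"
      proof (cases "Delta B fbar C S > 0")
        case True
        with cyc[OF S] show ?thesis by (simp add: D \<theta>_def mult.commute)
      next
        case False
        then have "\<theta> * Delta B fbar C S \<le> 0" using \<theta>0 by (intro mult_nonneg_nonpos) auto
        moreover have "\<bar>\<Sum>a\<in>S. f $ a / B a\<bar> \<le> (\<Sum>a\<in>S. ?w a * x $ a)"
          using S g by (intro order_trans[OF sum_abs] sum_mono) auto
        ultimately show ?thesis by (simp add: D)
      qed
    qed (use g \<theta>0 \<theta>_le in auto)
    then obtain h where h: "sum h C = 0" "\<And>a. a \<in> C \<Longrightarrow> \<bar>h a\<bar> \<le> \<theta> * ?w a"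
      "\<And>a. a \<in> C \<Longrightarrow> \<bar>f $ a / B a - h a\<bar> \<le> ?w a * (x $ a - \<theta>)" by blast
    \<comment> \<open>Back from \<open>g = f / B\<close> to flows.\<close>
    define k :: "'v arc_vec" where "k = (\<chi> a. if a \<in> C then B a * h a else 0)"
    have k: "\<bar>k $ a\<bar> \<le> \<theta> * fbar a" "\<bar>f $ a - k $ a\<bar> \<le> fbar a * (x $ a - \<theta>)" if "a \<in> C" for a
    proof -
      have "B a * \<bar>h a\<bar> \<le> B a * (\<theta> * ?w a)"
        using B[OF that] h(2)[OF that] by (intro mult_left_mono) auto
      then show "\<bar>k $ a\<bar> \<le> \<theta> * fbar a"
        using B[OF that] that by (simp add: k_def abs_mult weight_def)
      have "B a * \<bar>f $ a / B a - h a\<bar> \<le> B a * (?w a * (x $ a - \<theta>))"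
        using B[OF that] h(3)[OF that] by (intro mult_left_mono) auto
      moreover have "B a * \<bar>f $ a / B a - h a\<bar> = \<bar>B a * (f $ a / B a - h a)\<bar>"
        using B[OF that] by (simp add: abs_mult)
      ultimately show "\<bar>f $ a - k $ a\<bar> \<le> fbar a * (x $ a - \<theta>)"
        using B[OF that] that by (simp add: k_def weight_def right_diff_distrib)
    qed
    have "(\<Sum>a\<in>C. k $ a / B a) = sum h C"
      by (rule sum.cong) (use B in \<open>force simp: k_def\<close>)+
    then have k_sum: "(\<Sum>a\<in>C. k $ a / B a) = 0" using h(1) by simp
    have k_on: "k \<in> vecs_on C" by (simp add: k_def vecs_on_def)
    define one :: "'v arc_vec" where "one = (\<chi> a. if a \<in> C then 1 else 0)"
    have closed: "((1 / \<theta>) *\<^sub>R k, one) \<in> ?K"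
      unfolding one_def
    proof (intro hull_inc closed_point_in_cycle_set)
      show "(1 / \<theta>) *\<^sub>R k \<in> vecs_on C" using k_on by (simp add: vecs_on_def)
      show "\<bar>((1 / \<theta>) *\<^sub>R k) $ a\<bar> \<le> fbar a" if "a \<in> C" for a
        using k(1)[OF that] \<theta>0 by (simp add: field_simps)
      have "(\<Sum>a\<in>C. ((1 / \<theta>) *\<^sub>R k) $ a / B a) = (1 / \<theta>) * (\<Sum>a\<in>C. k $ a / B a)"
        by (simp add: sum_distrib_left)
      then show "(\<Sum>a\<in>C. ((1 / \<theta>) *\<^sub>R k) $ a / B a) = 0" using k_sum by simp
    qed
    show ?thesis
    proof (cases "\<theta> = 1")
      case True
      have xa: "x $ a = 1" if "a \<in> C" for a
        using \<theta>_le[OF that] x1[OF that] True by simp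
      have "k $ a = f $ a" for a
        using k(2)[of a] True xa[of a] on k_on by (cases a) (cases "a \<in> C"; auto simp: vecs_on_def)
      then have "k = f" by (simp add: vec_eq_iff)
      moreover have "one = x"
        using xa on by (auto simp: one_def vec_eq_iff vecs_on_def)
      ultimately show ?thesis using closed True by simp
    next
      case False
      then have \<theta>': "\<theta> < 1" using \<theta>1 by simp
      have "((1 / (1 - \<theta>)) *\<^sub>R (f - k), (1 / (1 - \<theta>)) *\<^sub>R (x - \<theta> *\<^sub>R one)) \<in> ?K"
      proof (rule relaxed)
        show "(1 / (1 - \<theta>)) *\<^sub>R (f - k) \<in> vecs_on C" "(1 / (1 - \<theta>)) *\<^sub>R (x - \<theta> *\<^sub>R one) \<in> vecs_on C"
          using on k_on by (auto simp: vecs_on_def one_def)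
        show "capacity_bounds fbar C ((1 / (1 - \<theta>)) *\<^sub>R (f - k)) ((1 / (1 - \<theta>)) *\<^sub>R (x - \<theta> *\<^sub>R one))"
          unfolding capacity_bounds_def
        proof
          fix a assume a: "a \<in> C"
          have "\<bar>(f $ a - k $ a) / (1 - \<theta>)\<bar> \<le> fbar a * (x $ a - \<theta>) / (1 - \<theta>)"
            using k(2)[OF a] \<theta>' by (simp add: divide_right_mono)
          then have "- (fbar a * (x $ a - \<theta>) / (1 - \<theta>)) \<le> (f $ a - k $ a) / (1 - \<theta>) \<and>
              (f $ a - k $ a) / (1 - \<theta>) \<le> fbar a * (x $ a - \<theta>) / (1 - \<theta>)"
            by linarith
          then show "- fbar a * ((1 / (1 - \<theta>)) *\<^sub>R (x - \<theta> *\<^sub>R one)) $ a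
                \<le> ((1 / (1 - \<theta>)) *\<^sub>R (f - k)) $ a \<and>
              ((1 / (1 - \<theta>)) *\<^sub>R (f - k)) $ a \<le> fbar a * ((1 / (1 - \<theta>)) *\<^sub>R (x - \<theta> *\<^sub>R one)) $ a"
            using a by (simp add: one_def)
        qed
        show "0 \<le> ((1 / (1 - \<theta>)) *\<^sub>R (x - \<theta> *\<^sub>R one)) $ a \<and>
            ((1 / (1 - \<theta>)) *\<^sub>R (x - \<theta> *\<^sub>R one)) $ a \<le> 1" if "a \<in> C" for a
          using \<theta>_le[OF that] x1[OF that] that \<theta>' by (simp add: one_def)
        have "(\<Sum>a\<in>C. 1 - ((1 / (1 - \<theta>)) *\<^sub>R (x - \<theta> *\<^sub>R one)) $ a)
            = (\<Sum>a\<in>C. (1 - x $ a) / (1 - \<theta>))"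
        proof (rule sum.cong[OF refl])
          fix a assume "a \<in> C"
          moreover have "1 - \<theta> \<noteq> 0" using \<theta>' by simp
          ultimately show "1 - ((1 / (1 - \<theta>)) *\<^sub>R (x - \<theta> *\<^sub>R one)) $ a = (1 - x $ a) / (1 - \<theta>)"
            by (simp add: one_def diff_divide_eq_iff eq_divide_eq)
        qed
        also have "\<dots> = (\<Sum>a\<in>C. 1 - x $ a) / (1 - \<theta>)"
          by (simp only: sum_divide_distrib)
        also have "\<dots> = 1" using \<theta>' by (simp add: \<theta>_def)
        finally show "1 \<le> (\<Sum>a\<in>C. 1 - ((1 / (1 - \<theta>)) *\<^sub>R (x - \<theta> *\<^sub>R one)) $ a)" by simp
      qed
      from convexD[OF convex_convex_hull closed this, of \<theta> "1 - \<theta>"] \<theta>0 \<theta>'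
      show ?thesis by simp
    qed
  qed
qed

theorem theorem4p1:
  fixes G :: "'v::finite pair_pre_digraph"
    and p :: "('v \<times> 'v) list"
    and C :: "('v \<times> 'v) set"
    and B fbar :: "'v \<times> 'v \<Rightarrow> real"
    and M :: real
  assumes "pair_wf_digraph G"
    and "pre_digraph.cycle (with_proj G) p"
    and "C = set p"
    and "\<And>a. a \<in> C \<Longrightarrow> B a > 0"
    and "\<And>a. a \<in> C \<Longrightarrow> fbar a > 0"
    and "valid_big_M B fbar C M"
  shows "convex hull (cycle_set B fbar M C) =
    {(f, x). f \<in> vecs_on C \<and> x \<in> vecs_on C \<and>
       capacity_bounds fbar C f x \<and> (\<forall>a\<in>C. x $ a \<le> 1) \<and>
       (\<forall>S. S \<subseteq> C \<and> Delta B fbar C S > 0 \<longrightarrow>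
          - Delta B fbar C S * (real (card C) - 1)
            + (\<Sum>a\<in>S. (Delta B fbar C S - weight B fbar a) * x $ a)
            + Delta B fbar C S * (\<Sum>a\<in>C - S. x $ a)
          \<le> (\<Sum>a\<in>S. f $ a / B a)
        \<and> (\<Sum>a\<in>S. f $ a / B a)
          \<le> Delta B fbar C S * (real (card C) - 1)
            - (\<Sum>a\<in>S. (Delta B fbar C S - weight B fbar a) * x $ a)
            - Delta B fbar C S * (\<Sum>a\<in>C - S. x $ a))}"
proof -
  have "convex hull (cycle_set B fbar M C) = cycle_polytope B fbar C"
  proof
    show "convex hull (cycle_set B fbar M C) \<subseteq> cycle_polytope B fbar C"
      using assms(4) by (intro hull_minimal cycle_set_subset_polytope convex_cycle_polytope)
    show "cycle_polytope B fbar C \<subseteq> convex hull (cycle_set B fbar M C)"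
      using assms(4-6) by (intro polytope_subset_hull)
  qed
  moreover have "\<bar>\<Sum>a\<in>S. f $ a / B a\<bar>
      \<le> (\<Sum>a\<in>S. weight B fbar a * x $ a) - Delta B fbar C S * (1 - (\<Sum>a\<in>C. 1 - x $ a)) \<longleftrightarrow>
    - Delta B fbar C S * (real (card C) - 1)
        + (\<Sum>a\<in>S. (Delta B fbar C S - weight B fbar a) * x $ a)
        + Delta B fbar C S * (\<Sum>a\<in>C - S. x $ a)
      \<le> (\<Sum>a\<in>S. f $ a / B a) \<and>
    (\<Sum>a\<in>S. f $ a / B a)
      \<le> Delta B fbar C S * (real (card C) - 1)
        - (\<Sum>a\<in>S. (Delta B fbar C S - weight B fbar a) * x $ a)
        - Delta B fbar C S * (\<Sum>a\<in>C - S. x $ a)" if "S \<subseteq> C" for S and f x :: "'v arc_vec"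
    unfolding cycle_inequality_rewrite[OF that, symmetric] by (auto simp: abs_le_iff)
  ultimately show ?thesis
    by (simp add: cycle_polytope_def cong: conj_cong)
qed

end
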